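(* Let $G$ be a connected finite $\delta$-hyperbolic graph and let $P(y,x)$ be a shortest path between vertices $y$ and $x$. (i) Any plain $(u,\dots,v)$ of $P(y,x)$ has width $d(u,v)\le 4\delta+1$. Terraces are absent if $\delta=0$ and have width at most $4\delta-1$ otherwise. Plateaus are absent if $\delta\le 1/2$ and have width at most $4\delta-3$ otherwise. (ii) Any plain $(u,\dots,v)$ of $P(y,x)$ with $e(u)>\min\{e(x),e(y)\}+\delta$ has width $d(u,v)\le 2\delta$, and if $(u,\dots,v)$ is a plateau it has width at most $2\delta-2$. In particular, if $\delta=1$, then plateaus on $P(y,x)$ are absent in eccentricity layers $C_k(G)$ for all $k>\min\{e(x),e(y)\}+1-rad(G)$; moreover, plateaus are completely absent if $\delta=1$ and every vertex $c\ne x$ of $P(y,x)$ has $e(c)>e(x)$. (iii) If there are two vertices $u,v\in P(y,x)$ with $e(u)=e(v)\ge\min\{e(x),e(y)\}$, $d(x,\{u,v\})>2\delta$ and $d(y,\{u,v\})>2\delta$, then $d(u,v)\le 2\delta$.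
   Context: $d$ is shortest-path distance; $d(v,S)=\min_{u\in S}d(v,u)$. $G$ is $\delta$-hyperbolic if for any four vertices $u,v,w,x$ the two larger of $d(u,v)+d(w,x)$, $d(u,w)+d(v,x)$, $d(u,x)+d(v,w)$ differ by at most $2\delta$. $e(v)=\max_u d(v,u)$, $rad(G)=\min_v e(v)$, $C_k(G)=\{v: e(v)=rad(G)+k\}$. For a path $P(y,x)=(y=v_0,\dots,v_p=x)$, an edge $(v_j,v_{j+1})$ is horizontal if $e(v_j)=e(v_{j+1})$. A plain is a maximal by inclusion subpath $(v_i,\dots,v_{i+\ell})$ all of whose edges are horizontal; $\ell$ is its width. A plain with $i>0$ and $i+\ell<p$ is a plateau if $e(v_{i-1})<e(v_i)$ and $e(v_{i+\ell+1})<e(v_{i+\ell})$, and a terrace if either $e(v_{i-1})<e(v_i)$ and $e(v_{i+\ell+1})>e(v_{i+\ell})$, or $e(v_{i-1})>e(v_i)$ and $e(v_{i+\ell+1})<e(v_{i+\ell})$. *)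

theory Defs
  imports "Graph_Theory.Graph_Theory"
begin

text \<open>
  Graphs are the finite simple undirected graphs of the \<^locale>\<open>graph\<close> locale
  (loop-free symmetric digraphs without parallel arcs). In a connected graph the infimum
  \<open>\<mu>\<close> is finite, so the conversion to a real number loses nothing.
\<close>

definition gdist :: "('a, 'b) pre_digraph \<Rightarrow> 'a \<Rightarrow> 'a \<Rightarrow> real" where
  "gdist G u v = real_of_ereal (wf_digraph.\<mu> G (\<lambda>_. 1) u v)"

definition set_dist :: "('a, 'b) pre_digraph \<Rightarrow> 'a \<Rightarrow> 'a set \<Rightarrow> real" where
  "set_dist G v S = Min (gdist G v ` S)"

definition ecc :: "('a, 'b) pre_digraph \<Rightarrow> 'a \<Rightarrow> real" where
  "ecc G v = Max (gdist G v ` verts G)"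

definition rad :: "('a, 'b) pre_digraph \<Rightarrow> real" where
  "rad G = Min (ecc G ` verts G)"

definition layer :: "('a, 'b) pre_digraph \<Rightarrow> nat \<Rightarrow> 'a set" where
  "layer G k = {v \<in> verts G. ecc G v = rad G + real k}"

definition hyperbolic :: "real \<Rightarrow> ('a, 'b) pre_digraph \<Rightarrow> bool" where
  "hyperbolic \<delta> G \<longleftrightarrow>
    (\<forall>u \<in> verts G. \<forall>v \<in> verts G. \<forall>w \<in> verts G. \<forall>x \<in> verts G.
      let s = sort [gdist G u v + gdist G w x,
                    gdist G u w + gdist G v x,
                    gdist G u x + gdist G v w]
      in s ! 2 - s ! 1 \<le> 2 * \<delta>)"

definition shortest_path :: "('a, 'b) pre_digraph \<Rightarrow> 'a list \<Rightarrow> 'a \<Rightarrow> 'a \<Rightarrow> bool" where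
  "shortest_path G P y x \<longleftrightarrow>
    vpath P G \<and> hd P = y \<and> last P = x \<and> real (vwalk_length P) = gdist G y x"

text \<open>
  The pair \<open>i l\<close> stands for the subpath \<open>P ! i, \<dots>, P ! (i + l)\<close>, which has \<open>l\<close> edges.
  Subpaths without edges are excluded: a single vertex is not a plain of width 0. Otherwise
  every strictly monotone stretch of eccentricities would contain terraces of width 0
  (even in trees), and isolated peaks would be plateaus.
\<close>

definition horizontal_subpath :: "('a, 'b) pre_digraph \<Rightarrow> 'a list \<Rightarrow> nat \<Rightarrow> nat \<Rightarrow> bool" where
  "horizontal_subpath G P i l \<longleftrightarrow>
    l > 0 \<and> i + l < length P \<and>
    (\<forall>j \<in> {i..<i + l}. ecc G (P ! j) = ecc G (P ! (j + 1)))"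

definition plain :: "('a, 'b) pre_digraph \<Rightarrow> 'a list \<Rightarrow> nat \<Rightarrow> nat \<Rightarrow> bool" where
  "plain G P i l \<longleftrightarrow>
    horizontal_subpath G P i l \<and>
    (\<forall>i' l'. horizontal_subpath G P i' l' \<and> {i..i + l} \<subseteq> {i'..i' + l'} \<longrightarrow> i' = i \<and> l' = l)"

definition plateau :: "('a, 'b) pre_digraph \<Rightarrow> 'a list \<Rightarrow> nat \<Rightarrow> nat \<Rightarrow> bool" where
  "plateau G P i l \<longleftrightarrow>
    plain G P i l \<and> i > 0 \<and> i + l < vwalk_length P \<and>
    ecc G (P ! (i - 1)) < ecc G (P ! i) \<and>
    ecc G (P ! (i + l + 1)) < ecc G (P ! (i + l))"

definition terrace :: "('a, 'b) pre_digraph \<Rightarrow> 'a list \<Rightarrow> nat \<Rightarrow> nat \<Rightarrow> bool" where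
  "terrace G P i l \<longleftrightarrow>
    plain G P i l \<and> i > 0 \<and> i + l < vwalk_length P \<and>
    (ecc G (P ! (i - 1)) < ecc G (P ! i) \<and> ecc G (P ! (i + l + 1)) > ecc G (P ! (i + l)) \<or>
     ecc G (P ! (i - 1)) > ecc G (P ! i) \<and> ecc G (P ! (i + l + 1)) < ecc G (P ! (i + l)))"

end

theory Submission
  imports Defs
begin

text \<open>
  Let \<open>c\<close> lie on a geodesic between \<open>a\<close> and \<open>b\<close>, and let \<open>z\<close> be a vertex furthest from \<open>c\<close>.
  The four-point condition on \<open>a, b, c, z\<close> yields \<open>d(c,b) + e(c) \<le> e(b) + 2\<delta>\<close> or
  \<open>d(c,a) + e(c) \<le> e(a) + 2\<delta>\<close>. Every bound is this disjunction for a suitable choice of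
  \<open>c\<close>, with \<open>a\<close> and \<open>b\<close> the ends of the plain, their outer neighbours on \<open>P\<close>, or an end
  of \<open>P\<close>. As distances and eccentricities are integers, \<open>2\<delta>\<close> may be replaced by
  \<open>m = \<lfloor>2\<delta>\<rfloor>\<close>, and what remains is integer arithmetic along \<open>P\<close>.
\<close>

section \<open>Distance and eccentricity in a connected graph\<close>

locale connected_graph = graph G for G :: "('a, 'b) pre_digraph" (structure) +
  assumes connected: "connected G"
begin

text \<open>Symmetry of the arcs turns connectedness into reachability, so the infimum
  \<open>\<mu>\<close> is finite and attained. Distances are therefore natural numbers.\<close>

lemma gdist_attained:
  assumes "u \<in> verts G" "v \<in> verts G"
  obtains p where "awalk u p v" "gdist G u v = real (length p)"
proof -
  have "u \<rightarrow>\<^sup>* v"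
    using symmetric_connected_imp_strongly_connected[OF sym_arcs connected] assms by blast
  then obtain p where "apath u p v" "\<mu> (\<lambda>_. 1) u v = awalk_cost (\<lambda>_. 1) p"
    using min_cost_awalk[of u v "\<lambda>_. 1"] by auto
  then show thesis
    by (intro that[of p]) (auto simp: apath_def gdist_def awalk_cost_def sum_list_triv)
qed

lemma gdist_le_length:
  assumes "awalk u p v"
  shows "gdist G u v \<le> real (length p)"
proof -
  have "\<mu> (\<lambda>_. 1) u v \<le> ereal (real (length p))"
    using min_cost_le_walk_cost[OF assms, of "\<lambda>_. 1"]
    by (simp add: awalk_cost_def sum_list_triv)
  moreover obtain q :: "'b list" where "gdist G u v = real (length q)"
    using gdist_attained[OF awalk_hd_in_verts[OF assms] awalk_last_in_verts[OF assms]] by metis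
  ultimately show ?thesis
    \<comment> \<open>\<open>real_of_ereal\<close> sends both infinities to 0. The bound above
      excludes \<infinity>, and the value 0 for -\<infinity> still respects the claim.\<close>
    unfolding gdist_def by (cases "\<mu> (\<lambda>_. 1) u v") auto
qed

text \<open>Every arc has a reverse arc, so a walk can be retraced; this yields the symmetry of
  \<open>gdist\<close>.\<close>

lemma awalk_reversal:
  assumes "awalk u p v"
  shows "\<exists>q. awalk v q u \<and> length q = length p"
  using assms
proof (induction p arbitrary: u)
  case Nil
  then show ?case by (auto simp: awalk_Nil_iff)
next
  case (Cons e p)
  then have e: "e \<in> arcs G" "tail G e = u" and "awalk (head G e) p v"
    by (auto simp: awalk_Cons_iff)
  with Cons.IH obtain q where q: "awalk v q (head G e)" "length q = length p"
    by blast
  obtain e' where "e' \<in> arcs G" "tail G e' = head G e" "head G e' = u"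
    using e sym_arcs unfolding symmetric_conv by metis
  then have "awalk (head G e) [e'] u"
    using arc_implies_awalk by metis
  with q have "awalk v (q @ [e']) u"
    using awalk_appendI by blast
  then show ?case
    using q by (intro exI[of _ "q @ [e']"]) auto
qed

lemma gdist_triangle:
  assumes "u \<in> verts G" "v \<in> verts G" "w \<in> verts G"
  shows "gdist G u w \<le> gdist G u v + gdist G v w"
proof -
  obtain p q where "awalk u p v" "gdist G u v = real (length p)"
    "awalk v q w" "gdist G v w = real (length q)"
    using gdist_attained assms by metis
  then show ?thesis
    using gdist_le_length[OF awalk_appendI[of u p v q w]] by simp
qed

lemma gdist_commute:
  assumes "u \<in> verts G" "v \<in> verts G"
  shows "gdist G u v = gdist G v u"
proof -
  have "gdist G v u \<le> gdist G u v" if "u \<in> verts G" "v \<in> verts G" for u v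
    using gdist_attained[OF that] awalk_reversal gdist_le_length by metis
  then show ?thesis
    using assms by (simp add: antisym)
qed

lemma gdist_adj:
  assumes "u \<rightarrow> v"
  shows "gdist G u v \<le> 1"
proof -
  obtain e where "e \<in> arcs G" "tail G e = u" "head G e = v"
    using assms by auto
  then have "awalk u [e] v"
    using arc_implies_awalk by metis
  then show ?thesis
    using gdist_le_length[of u "[e]" v] by simp
qed

lemma gdist_le_ecc: "v \<in> verts G \<Longrightarrow> gdist G u v \<le> ecc G u"
  unfolding ecc_def by (intro Max_ge) auto

lemma ecc_attained:
  assumes "u \<in> verts G"
  obtains z where "z \<in> verts G" "gdist G u z = ecc G u"
proof -
  have "ecc G u \<in> gdist G u ` verts G"
    unfolding ecc_def using assms by (intro Max_in) auto
  then show thesis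
    using that by auto
qed

text \<open>An eccentricity is an attained distance, hence the length of a walk.\<close>

lemma ecc_Ints: "u \<in> verts G \<Longrightarrow> ecc G u \<in> \<int>"
  by (metis ecc_attained gdist_attained Ints_of_nat)

lemma ecc_le_add_gdist:
  assumes "u \<in> verts G" "v \<in> verts G"
  shows "ecc G u \<le> ecc G v + gdist G u v"
proof -
  obtain z where "z \<in> verts G" "gdist G u z = ecc G u"
    using ecc_attained assms by metis
  then show ?thesis
    using gdist_triangle[of u v z] gdist_le_ecc[of z v] assms by linarith
qed

section \<open>The four-point condition\<close>

text \<open>If the left sum is the largest of the three, the maximum on the right is the second
  largest. Otherwise that maximum already bounds it, and 2\<delta> is nonnegative because it bounds
  a difference of sorted entries.\<close>

lemma hyperbolic_four_point:
  assumes "hyperbolic \<delta> G" "u \<in> verts G" "v \<in> verts G" "w \<in> verts G" "x \<in> verts G"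
  shows "gdist G u v + gdist G w x
    \<le> max (gdist G u w + gdist G v x) (gdist G u x + gdist G v w) + 2 * \<delta>"
proof -
  have "sort [a, b, c] ! 2 - sort [a, b, c] ! 1 \<le> r \<Longrightarrow> a \<le> max b c + r" for a b c r :: real
    by (auto split: if_splits)
  then show ?thesis
    using assms unfolding hyperbolic_def Let_def by blast
qed

text \<open>For four equal vertices all three sums agree; a vertex exists because
  \<open>connected\<close> includes nonemptiness.\<close>

lemma hyperbolic_nonneg:
  assumes "hyperbolic \<delta> G"
  shows "0 \<le> \<delta>"
proof -
  obtain u where "u \<in> verts G"
    using connected by (auto simp: connected_def strongly_connected_def)
  then show ?thesis
    using hyperbolic_four_point[OF assms, of u u u u] by simp
qed

text \<open>The sum d(a,b) + d(c,z) equals d(a,c) + d(c,b) + e(c). Comparing it with d(a,c) + d(b,z)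
  cancels d(a,c), and with d(a,z) + d(b,c) cancels d(c,b).\<close>

lemma ecc_between:
  assumes "hyperbolic \<delta> G" "a \<in> verts G" "b \<in> verts G" "c \<in> verts G"
    and "gdist G a b = gdist G a c + gdist G c b"
  shows "gdist G c b + ecc G c \<le> ecc G b + 2 * \<delta> \<or> gdist G a c + ecc G c \<le> ecc G a + 2 * \<delta>"
proof -
  obtain z where z: "z \<in> verts G" "gdist G c z = ecc G c"
    using ecc_attained assms by metis
  then have "gdist G b z \<le> ecc G b" "gdist G a z \<le> ecc G a"
    using gdist_le_ecc by auto
  then show ?thesis
    using hyperbolic_four_point[OF assms(1-4) z(1)] z(2) assms(5)
      gdist_commute[OF assms(3,4)] by (auto simp: max_def split: if_splits)
qed

section \<open>Subpaths of geodesics\<close>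

lemma vwalk_adj_nth:
  assumes "vwalk P G" "Suc i < length P"
  shows "P ! i \<rightarrow> P ! Suc i"
  using assms
proof (induction P arbitrary: i rule: vwalk_arcs.induct)
  case (3 u v ws)
  then show ?case by (cases i) auto
qed auto

lemma gdist_vwalk_nth:
  assumes "vwalk P G" "i \<le> j" "j < length P"
  shows "gdist G (P ! i) (P ! j) \<le> real j - real i"
  using assms(2,3)
proof (induction j rule: dec_induct)
  case base
  then have "awalk (P ! i) [] (P ! i)"
    using vwalk_verts_in_verts[OF assms(1) nth_mem] by (simp add: awalk_Nil_iff)
  then show ?case
    using gdist_le_length by fastforce
next
  case (step j)
  then have "P ! i \<in> verts G" "P ! j \<in> verts G" "P ! Suc j \<in> verts G"
    using vwalk_verts_in_verts[OF assms(1) nth_mem] by auto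
  then show ?case
    using step gdist_triangle[of "P ! i" "P ! j" "P ! Suc j"]
      gdist_adj[OF vwalk_adj_nth[OF assms(1), of j]] by force
qed

lemma shortest_path_gdist_nth:
  assumes P: "shortest_path G P y x" and "i \<le> j" "j < length P"
  shows "gdist G (P ! i) (P ! j) = real j - real i"
proof (rule antisym)
  have walk: "vwalk P G"
    using P by (auto simp: shortest_path_def)
  show "gdist G (P ! i) (P ! j) \<le> real j - real i"
    using gdist_vwalk_nth[OF walk] assms by simp
  let ?n = "length P - 1"
  have ne: "P \<noteq> []" using assms by auto
  have V: "P ! k \<in> verts G" if "k < length P" for k
    using vwalk_verts_in_verts[OF walk nth_mem] that .
  have "gdist G (P ! 0) (P ! ?n) = real ?n"
    using P ne by (simp add: shortest_path_def hd_conv_nth last_conv_nth)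
  \<comment> \<open>The pieces before \<open>i\<close>, from \<open>i\<close> to \<open>j\<close>
    and after \<open>j\<close> have distances at most their numbers of edges. As these add up to the
    full distance, none can fall short.\<close>
  moreover have "gdist G (P ! 0) (P ! ?n) \<le> gdist G (P ! 0) (P ! i) + gdist G (P ! i) (P ! ?n)"
    "gdist G (P ! i) (P ! ?n) \<le> gdist G (P ! i) (P ! j) + gdist G (P ! j) (P ! ?n)"
    using ne assms(2,3) by (auto intro!: gdist_triangle V)
  moreover have "gdist G (P ! 0) (P ! i) \<le> real i" "gdist G (P ! j) (P ! ?n) \<le> real ?n - real j"
    using gdist_vwalk_nth[OF walk, of 0 i] gdist_vwalk_nth[OF walk, of j ?n] assms by auto
  ultimately show "real j - real i \<le> gdist G (P ! i) (P ! j)"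
    by linarith
qed

end

section \<open>Integer inequalities for an eccentricity profile\<close>

text \<open>
  Here \<open>f j\<close> stands for the eccentricity of the \<open>j\<close>-th vertex of a geodesic with \<open>n\<close> edges,
  and \<open>m\<close> for \<open>\<lfloor>2\<delta>\<rfloor>\<close>.
\<close>

locale ecc_profile =
  fixes f :: "nat \<Rightarrow> int" and n :: nat and m :: int
  assumes m_nonneg: "0 \<le> m"
    and lipschitz: "\<lbrakk>i \<le> j; j \<le> n\<rbrakk> \<Longrightarrow> \<bar>f i - f j\<bar> \<le> int j - int i"
    and between: "\<lbrakk>i \<le> j; j \<le> k; k \<le> n\<rbrakk> \<Longrightarrow>
      int k - int j + f j \<le> f k + m \<or> int j - int i + f j \<le> f i + m"
begin

lemma plain_width:
  assumes "i + l \<le> n" "\<And>j. i \<le> j \<Longrightarrow> j \<le> i + l \<Longrightarrow> f j = f i"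
  shows "int l \<le> 2 * m + 1"
proof (rule ccontr)
  assume "\<not> ?thesis"
  \<comment> \<open>With l \<ge> 2m + 2 this index is more than m away from both ends of the plain,
    while at equal levels \<open>between\<close> puts it within m of one of them.\<close>
  moreover define j where "j = i + nat (m + 1)"
  ultimately have "i \<le> j" "j \<le> i + l" "int j = int i + m + 1" "int l > 2 * m + 1"
    using m_nonneg by auto
  then show False
    using between[of i j "i + l"] assms(1) assms(2)[of j] assms(2)[of "i + l"] by auto
qed

text \<open>A terrace goes down on exactly one side, and one lower outer neighbour gains 2 over a
  plain: the segment grows by one edge and its end value drops by at least 1.\<close>

lemma terrace_width:
  assumes "0 < i" "0 < l" "i + l < n" "\<And>j. i \<le> j \<Longrightarrow> j \<le> i + l \<Longrightarrow> f j = f i"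
    and "f (i - 1) < f i \<or> f (i + l + 1) < f (i + l)"
  shows "int l \<le> 2 * m - 1"
proof (rule ccontr)
  assume "\<not> ?thesis"
  then have l: "2 * m \<le> int l" by simp
  have eq: "f (i + l) = f i" using assms(4)[of "i + l"] by simp
  from assms(5) show False
  proof
    assume left: "f (i - 1) < f i"
    \<comment> \<open>The left alternative would force j - i \<le> m - 2, the right one l \<le> (j -
      i) + m. For m = 0 the offset truncates to 0 and \<open>0 < l\<close> refutes the right
      one.\<close>
    define j where "j = i + nat (m - 1)"
    have j: "i \<le> j" "j \<le> i + l" "int j = int i + max (m - 1) 0"
      using l m_nonneg assms(2) by (auto simp: j_def)
    then have "f j = f i" "int (i - 1) = int i - 1" "int (i + l) = int i + int l" "int l > 0"
      using assms(1,2) assms(4)[of j] by auto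
    moreover have "int (i + l) - int j + f j \<le> f (i + l) + m \<or>
        int j - int (i - 1) + f j \<le> f (i - 1) + m"
      using j assms(3) by (intro between) auto
    ultimately show False
      using left eq l j(3) by linarith
  next
    assume right: "f (i + l + 1) < f (i + l)"
    \<comment> \<open>Mirror image, with the offset counted from the right end.\<close>
    define j where "j = i + l - nat (m - 1)"
    have j: "i \<le> j" "j \<le> i + l" "int j = int i + int l - max (m - 1) 0"
      using l m_nonneg assms(2) by (auto simp: j_def)
    then have "f j = f i" "int (i + l + 1) = int i + int l + 1" "int l > 0"
      using assms(1,2) assms(4)[of j] by auto
    moreover have "int (i + l + 1) - int j + f j \<le> f (i + l + 1) + m \<or>
        int j - int i + f j \<le> f i + m"
      using j assms(3) by (intro between) auto
    ultimately show False
      using right eq l j(3) by linarith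
  qed
qed

lemma plateau_width:
  assumes "0 < i" "i + l < n" "\<And>j. i \<le> j \<Longrightarrow> j \<le> i + l \<Longrightarrow> f j = f i"
    and "f (i - 1) < f i" "f (i + l + 1) < f (i + l)"
  shows "int l \<le> 2 * m - 3"
proof (rule ccontr)
  assume "\<not> ?thesis"
  then have l: "2 * m - 2 \<le> int l" by simp
  \<comment> \<open>Now both outer neighbours are lower, so the alternatives force j - i \<le> m - 2
    or l \<le> (j - i) + m - 2.\<close>
  define j where "j = i + nat (m - 1)"
  have j: "i \<le> j" "j \<le> i + l" "int j = int i + max (m - 1) 0"
    using l m_nonneg by (auto simp: j_def)
  then have "f j = f i" "f (i + l) = f i" "int (i - 1) = int i - 1"
      "int (i + l + 1) = int i + int l + 1"
    using assms(1) assms(3)[of j] assms(3)[of "i + l"] by auto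
  moreover have "int (i + l + 1) - int j + f j \<le> f (i + l + 1) + m \<or>
      int j - int (i - 1) + f j \<le> f (i - 1) + m"
    using j assms(2) by (intro between) auto
  ultimately show False
    using assms(4,5) l j(3) by linarith
qed

text \<open>If \<open>between\<close> chose the end \<open>n\<close>, then n - j \<le> f n - f j +
  m, while f j - f n \<le> n - j by \<open>lipschitz\<close>. Together 2 (f j - f n) \<le> m, so the
  other alternative remains.\<close>

lemma high_above_last:
  assumes "i \<le> j" "j \<le> n" "2 * f j > 2 * f n + m"
  shows "int j - int i + f j \<le> f i + m"
  using between[of i j n] lipschitz[of j n] assms by linarith

lemma high_above_first:
  assumes "i \<le> j" "j \<le> n" "2 * f i > 2 * f 0 + m"
  shows "int j - int i + f i \<le> f j + m"
  using between[of 0 i j] lipschitz[of 0 i] assms by linarith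

lemma high_plain_width:
  assumes "i + l \<le> n" "f (i + l) = f i" "2 * f i > 2 * min (f n) (f 0) + m"
  shows "int l \<le> m"
  using high_above_last[of i "i + l"] high_above_first[of i "i + l"] assms
  by (auto simp: min_def split: if_splits)

text \<open>The lower end of \<open>P\<close> is ruled out by height. The segment towards the other
  end includes the outer neighbour there, which adds one edge and drops by at least 1, hence m -
  2.\<close>

lemma high_plateau_width:
  assumes "0 < i" "i + l < n" "f (i + l) = f i" "2 * f i > 2 * min (f n) (f 0) + m"
    and "f (i - 1) < f i" "f (i + l + 1) < f (i + l)"
  shows "int l \<le> m - 2"
proof (cases "f n \<le> f 0")
  case True
  then have "int (i + l) - int (i - 1) + f (i + l) \<le> f (i - 1) + m"
    using assms by (intro high_above_last) auto
  then show ?thesis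
    using assms by auto
next
  case False
  then have "int (i + l + 1) - int i + f i \<le> f (i + l + 1) + m"
    using assms by (intro high_above_first) auto
  then show ?thesis
    using assms by auto
qed

text \<open>The lower end of \<open>P\<close> is no higher than the common level and more than m
  away, so \<open>between\<close> cannot choose it.\<close>

lemma equal_level_width:
  assumes "i \<le> j" "j \<le> n" "f i = f j" "f j \<ge> min (f n) (f 0)"
    and "int n - int j > m" "int i > m"
  shows "int j - int i \<le> m"
  using between[of i j n] between[of 0 i j] assms by (auto simp: min_def split: if_splits)

end

theorem theorem16:
  fixes G :: "('a, 'b) pre_digraph" and \<delta> :: real and P :: "'a list" and x y :: 'a
  assumes "graph G" and "connected G" and "hyperbolic \<delta> G"
    and "x \<in> verts G" and "y \<in> verts G" and "shortest_path G P y x"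
  shows
    "((\<forall>i l. plain G P i l \<longrightarrow>
         real l = gdist G (P ! i) (P ! (i + l)) \<and> gdist G (P ! i) (P ! (i + l)) \<le> 4 * \<delta> + 1) \<and>
      (if \<delta> = 0 then \<not> (\<exists>i l. terrace G P i l)
       else (\<forall>i l. terrace G P i l \<longrightarrow> real l \<le> 4 * \<delta> - 1)) \<and>
      (if \<delta> \<le> 1/2 then \<not> (\<exists>i l. plateau G P i l)
       else (\<forall>i l. plateau G P i l \<longrightarrow> real l \<le> 4 * \<delta> - 3)))
     \<and>
     ((\<forall>i l. plain G P i l \<and> ecc G (P ! i) > min (ecc G x) (ecc G y) + \<delta> \<longrightarrow>
         real l = gdist G (P ! i) (P ! (i + l)) \<and> gdist G (P ! i) (P ! (i + l)) \<le> 2 * \<delta> \<and>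
         (plateau G P i l \<longrightarrow> real l \<le> 2 * \<delta> - 2)) \<and>
      (\<delta> = 1 \<longrightarrow>
         (\<forall>k::nat. real k > min (ecc G x) (ecc G y) + 1 - rad G \<longrightarrow>
            \<not> (\<exists>i l. plateau G P i l \<and> (\<forall>j \<in> {i..i + l}. P ! j \<in> layer G k)))) \<and>
      (\<delta> = 1 \<and> (\<forall>c \<in> set P. c \<noteq> x \<longrightarrow> ecc G c > ecc G x) \<longrightarrow>
         \<not> (\<exists>i l. plateau G P i l)))
     \<and>
     (\<forall>u \<in> set P. \<forall>v \<in> set P.
        ecc G u = ecc G v \<and> ecc G u \<ge> min (ecc G x) (ecc G y) \<and>
        set_dist G x {u, v} > 2 * \<delta> \<and> set_dist G y {u, v} > 2 * \<delta> \<longrightarrow>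
        gdist G u v \<le> 2 * \<delta>)"
proof -
  interpret graph G by fact
  interpret connected_graph G by unfold_locales fact

  \<comment> \<open>Reduction of the geodesic to its integer profile\<close>
  define n where "n = length P - 1"
  define f where "f j = \<lfloor>ecc G (P ! j)\<rfloor>" for j
  define m where "m = \<lfloor>2 * \<delta>\<rfloor>"
  have m: "real_of_int m \<le> 2 * \<delta>" "2 * \<delta> < real_of_int m + 1"
    unfolding m_def by linarith+
  have "0 \<le> \<delta>"
    using hyperbolic_nonneg assms by blast
  have ne: "P \<noteq> []" and walk: "vwalk P G"
    using assms(6) by (auto simp: shortest_path_def vpath_def)
  then have ends: "P ! 0 = y" "P ! n = x"
    using assms(6) by (auto simp: shortest_path_def n_def hd_conv_nth last_conv_nth)
  have len: "j < length P \<longleftrightarrow> j \<le> n" for j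
    using ne by (cases P) (auto simp: n_def)
  have V: "P ! j \<in> verts G" if "j \<le> n" for j
    using vwalk_verts_in_verts[OF walk nth_mem] len that by blast
  have dist: "gdist G (P ! i) (P ! j) = real j - real i" if "i \<le> j" "j \<le> n" for i j
    using shortest_path_gdist_nth[OF assms(6)] that len by blast
  \<comment> \<open>The floor is exact, since eccentricities are integers.\<close>
  have ecc: "ecc G (P ! j) = real_of_int (f j)" if "j \<le> n" for j
    unfolding f_def using ecc_Ints[OF V[OF that]] by (auto elim: Ints_cases)
  then have ecc_ends: "ecc G y = real_of_int (f 0)" "ecc G x = real_of_int (f n)"
    using ends by auto
  interpret ecc_profile f n m
  proof
    show "0 \<le> m" using \<open>0 \<le> \<delta>\<close> by (simp add: m_def)
  next
    fix i j :: nat assume ij: "i \<le> j" "j \<le> n"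
    then have "\<bar>real_of_int (f i) - real_of_int (f j)\<bar> \<le> real j - real i"
      using ecc_le_add_gdist[OF V V, of i j] ecc_le_add_gdist[OF V V, of j i]
        gdist_commute[OF V V, of i j] dist[of i j] ecc[of i] ecc[of j] by auto
    then show "\<bar>f i - f j\<bar> \<le> int j - int i" by linarith
  next
    fix i j k :: nat assume ijk: "i \<le> j" "j \<le> k" "k \<le> n"
    then have "real k - real j + f j \<le> f k + 2 * \<delta> \<or> real j - real i + f j \<le> f i + 2 * \<delta>"
      using ecc_between[OF assms(3) V V V, of i k j]
        dist[of i j] dist[of j k] dist[of i k] ecc[of i] ecc[of j] ecc[of k] by auto
    then show "int k - int j + f j \<le> f k + m \<or> int j - int i + f j \<le> f i + m"
      using m by linarith
  qed

  have plain: "0 < l" "i + l \<le> n" "real l = gdist G (P ! i) (P ! (i + l))"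
    and level: "\<And>j. i \<le> j \<Longrightarrow> j \<le> i + l \<Longrightarrow> f j = f i" if "plain G P i l" for i l
  proof -
    have h: "0 < l" "i + l \<le> n" "\<And>j. i \<le> j \<Longrightarrow> j < i + l \<Longrightarrow> ecc G (P ! Suc j) = ecc G (P ! j)"
      using that len by (auto simp: plain_def horizontal_subpath_def)
    then show "0 < l" "i + l \<le> n" "real l = gdist G (P ! i) (P ! (i + l))"
      using dist[of i "i + l"] by auto
    show "f j = f i" if "i \<le> j" "j \<le> i + l" for j
      using that by (induction j rule: dec_induct) (auto simp: f_def h(3))
  qed
  have terrace: "int l \<le> 2 * m - 1" if "terrace G P i l" for i l
  proof -
    have "plain G P i l" "0 < i" "i + l < n"
      using that by (auto simp: terrace_def n_def)
    then show ?thesis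
      using that plain(1) ecc[of "i - 1"] ecc[of i] ecc[of "i + l"] ecc[of "i + l + 1"]
      by (intro terrace_width[of i l] level[of i l]) (auto simp: terrace_def)
  qed
  have plateau: "plain G P i l \<and> 0 < i \<and> i + l < n \<and> f (i - 1) < f i \<and>
      f (i + l + 1) < f (i + l)" if "plateau G P i l" for i l
  proof -
    have "plain G P i l" "0 < i" "i + l < n"
      using that by (auto simp: plateau_def n_def)
    then show ?thesis
      using that ecc[of "i - 1"] ecc[of i] ecc[of "i + l"] ecc[of "i + l + 1"]
      by (auto simp: plateau_def)
  qed
  have plateau_width: "int l \<le> 2 * m - 3" if "plateau G P i l" for i l
    using plateau[OF that] by (intro plateau_width[of i l] level[of i l]) auto
  have high: "2 * f i > 2 * min (f n) (f 0) + m"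
    if "ecc G (P ! i) > min (ecc G x) (ecc G y) + \<delta>" "i \<le> n" for i
  proof -
    \<comment> \<open>Doubling turns the threshold \<delta> into 2\<delta>, which is at least
      m.\<close>
    have "real_of_int (2 * f i) > real_of_int (2 * min (f n) (f 0) + m)"
      using that m ecc[of i] ecc_ends by (auto simp: min_def split: if_splits)
    then show ?thesis by linarith
  qed
  have high_plain: "int l \<le> m"
    if "plain G P i l" "ecc G (P ! i) > min (ecc G x) (ecc G y) + \<delta>" for i l
    using high_plain_width[of i l] high[of i] plain[OF that(1)] level[OF that(1), of "i + l"] that
    by auto
  have high_plateau: "int l \<le> m - 2"
    if "plateau G P i l" "ecc G (P ! i) > min (ecc G x) (ecc G y) + \<delta>" for i l
    using high_plateau_width[of i l] high[of i] plateau[OF that(1)] level[of i l "i + l"] that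
    by auto

  \<comment> \<open>The claims in terms of \<delta>\<close>
  have i: "(\<forall>i l. plain G P i l \<longrightarrow>
         real l = gdist G (P ! i) (P ! (i + l)) \<and> gdist G (P ! i) (P ! (i + l)) \<le> 4 * \<delta> + 1)"
  proof (intro allI impI)
    fix i l assume "plain G P i l"
    then have "real l = gdist G (P ! i) (P ! (i + l))" "int l \<le> 2 * m + 1"
      using plain[of i l] level[of i l] plain_width[of i l] by blast+
    then show "real l = gdist G (P ! i) (P ! (i + l)) \<and> gdist G (P ! i) (P ! (i + l)) \<le> 4 * \<delta> + 1"
      using m by linarith
  qed
  have i': "(if \<delta> = 0 then \<not> (\<exists>i l. terrace G P i l)
       else (\<forall>i l. terrace G P i l \<longrightarrow> real l \<le> 4 * \<delta> - 1))"
  proof -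
    have "real l \<le> 4 * \<delta> - 1" if "terrace G P i l" for i l
      using terrace[OF that] m by linarith
    \<comment> \<open>For \<delta> = 0 the bound is -1, below every natural width.\<close>
    then show ?thesis by fastforce
  qed
  have i'': "(if \<delta> \<le> 1/2 then \<not> (\<exists>i l. plateau G P i l)
       else (\<forall>i l. plateau G P i l \<longrightarrow> real l \<le> 4 * \<delta> - 3))"
  proof -
    have "real l \<le> 4 * \<delta> - 3" if "plateau G P i l" for i l
      using plateau_width[OF that] m by linarith
    \<comment> \<open>For \<delta> \<le> 1/2 the bound is at most -1, so no plateau exists.\<close>
    then show ?thesis by fastforce
  qed
  have ii: "\<forall>i l. plain G P i l \<and> ecc G (P ! i) > min (ecc G x) (ecc G y) + \<delta> \<longrightarrow>
         real l = gdist G (P ! i) (P ! (i + l)) \<and> gdist G (P ! i) (P ! (i + l)) \<le> 2 * \<delta> \<and>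
         (plateau G P i l \<longrightarrow> real l \<le> 2 * \<delta> - 2)"
  proof (intro allI impI, elim conjE)
    fix i l assume a: "plain G P i l" "ecc G (P ! i) > min (ecc G x) (ecc G y) + \<delta>"
    have "real l \<le> 2 * \<delta>"
      using high_plain[OF a] m by linarith
    moreover have "real l \<le> 2 * \<delta> - 2" if "plateau G P i l"
      using high_plateau[OF that a(2)] m by linarith
    ultimately show "real l = gdist G (P ! i) (P ! (i + l)) \<and>
        gdist G (P ! i) (P ! (i + l)) \<le> 2 * \<delta> \<and> (plateau G P i l \<longrightarrow> real l \<le> 2 * \<delta> - 2)"
      using plain(3)[OF a(1)] by auto
  qed
  have high_plateau_1: False
    if "\<delta> = 1" "plateau G P i l" "ecc G (P ! i) > min (ecc G x) (ecc G y) + 1" for i l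
    \<comment> \<open>Here m = 2, so the width would be at most 0, but a plain has an edge.\<close>
    using high_plateau[of i l] plateau[of i l] plain(1)[of i l] that by (auto simp: m_def)
  have ii': "\<delta> = 1 \<longrightarrow>
         (\<forall>k::nat. real k > min (ecc G x) (ecc G y) + 1 - rad G \<longrightarrow>
            \<not> (\<exists>i l. plateau G P i l \<and> (\<forall>j \<in> {i..i + l}. P ! j \<in> layer G k)))"
  proof (intro allI impI notI, elim exE conjE)
    fix k i l
    assume "\<delta> = 1" "real k > min (ecc G x) (ecc G y) + 1 - rad G" "plateau G P i l"
      and "\<forall>j \<in> {i..i + l}. P ! j \<in> layer G k"
    moreover from this have "P ! i \<in> layer G k" by auto
    ultimately show False
      using high_plateau_1[of i l] by (auto simp: layer_def)
  qed
  have ii'': "\<delta> = 1 \<and> (\<forall>c \<in> set P. c \<noteq> x \<longrightarrow> ecc G c > ecc G x) \<longrightarrow>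
         \<not> (\<exists>i l. plateau G P i l)"
  proof (intro impI notI, elim exE conjE)
    fix i l
    assume a: "\<delta> = 1" "\<forall>c \<in> set P. c \<noteq> x \<longrightarrow> ecc G c > ecc G x" "plateau G P i l"
    have p: "0 < i" "i + l < n" "f (i - 1) < f i"
      using plateau[OF a(3)] by auto
    \<comment> \<open>The vertex before the plateau has positive distance to \<open>x\<close>, so it
      is not \<open>x\<close> and lies strictly above it. The plateau is higher still, hence by
      integrality at least 2 above \<open>x\<close>.\<close>
    then have "gdist G (P ! (i - 1)) (P ! n) = real n - real (i - 1)" "i - 1 < n"
      "gdist G (P ! n) (P ! n) = 0"
      using dist[of "i - 1" n] dist[of n n] by auto
    then have "P ! (i - 1) \<noteq> x" "P ! (i - 1) \<in> set P"
      using ends len[of "i - 1"] by auto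
    then have "f n < f (i - 1)"
      using a(2) ecc[of "i - 1"] ecc_ends p by force
    then have "real_of_int (f i) > real_of_int (f n) + 1"
      using p by linarith
    then have "ecc G (P ! i) > min (ecc G x) (ecc G y) + 1"
      using ecc[of i] ecc_ends p by (simp add: min_def)
    then show False
      using high_plateau_1[OF a(1,3)] by blast
  qed
  have iii_le: "gdist G (P ! i) (P ! j) \<le> 2 * \<delta>"
    if "i \<le> j" "j \<le> n" "ecc G (P ! i) = ecc G (P ! j)"
      "ecc G (P ! i) \<ge> min (ecc G x) (ecc G y)"
      "gdist G x (P ! j) > 2 * \<delta>" "gdist G y (P ! i) > 2 * \<delta>" for i j
  proof -
    \<comment> \<open>\<open>P\<close> runs from \<open>y\<close> to \<open>x\<close>, so of the two
      vertices index \<open>i\<close> is the one nearer \<open>y\<close> and \<open>j\<close> the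
      one nearer \<open>x\<close>.\<close>
    have "real n - real j > 2 * \<delta>" "real i > 2 * \<delta>"
      using that dist[of j n] dist[of 0 i] ends gdist_commute[OF assms(4) V, of j] by auto
    then have "int n - int j > m" "int i > m"
      using m by linarith+
    moreover have "f i = f j" "f j \<ge> min (f n) (f 0)"
      using that ecc[of i] ecc[of j] ecc_ends by (auto simp: min_def split: if_splits)
    ultimately have "int j - int i \<le> m"
      using equal_level_width[of i j] that by blast
    then show ?thesis
      using dist[of i j] that m by linarith
  qed
  have iii: "gdist G u v \<le> 2 * \<delta>"
    if uv: "u \<in> set P" "v \<in> set P" and e: "ecc G u = ecc G v" "ecc G u \<ge> min (ecc G x) (ecc G y)"
      and d: "set_dist G x {u, v} > 2 * \<delta>" "set_dist G y {u, v} > 2 * \<delta>" for u v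
  proof -
    obtain i j where ij: "i \<le> n" "u = P ! i" "j \<le> n" "v = P ! j"
      using uv len by (metis in_set_conv_nth)
    have d': "gdist G x u > 2 * \<delta>" "gdist G x v > 2 * \<delta>"
      "gdist G y u > 2 * \<delta>" "gdist G y v > 2 * \<delta>"
      using d by (auto simp: set_dist_def)
    show ?thesis
    proof (cases "i \<le> j")
      case True
      then show ?thesis
        using iii_le[of i j] ij d' e by auto
    next
      case False
      then show ?thesis
        using iii_le[of j i] ij d' e gdist_commute[OF V V, of i j] by auto
    qed
  qed
  show ?thesis
    using i i' i'' ii ii' ii'' iii by blast
qed

end
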